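(* Suppose there exists a constant $p>0$ such that no point $x\ne0$ of the set $\Omega^{clf}_{\overline{cbf}}\cap\mathrm{Int}(\mathscr{C})$ (where $\Omega^{clf}_{\overline{cbf}}$ is taken with this $p$) satisfies $$f(x)=p\,\gamma(V(x))\,g(x)\,L_gV(x)^\top .$$ Let $u^\star(x)$ be the $u$-component of the pointwise solution, with this $p$, of the quadratic program $$\min_{(u,\delta)\in\mathbb{R}^{m+1}} \tfrac12\|u\|^2+\tfrac12 p\,\delta^2\quad\text{s.t.}\quad L_fV(x)+L_gV(x)u+\gamma(V(x))\le\delta,\qquad L_fh(x)+L_gh(x)u+\alpha(h(x))\ge 0 .$$ Then the closed-loop system $\dot x=f(x)+g(x)u^\star(x)$ has no equilibrium points in $\mathrm{Int}(\mathscr{C})$ except (possibly) the origin.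
   Context: Setting: $\dot x=f(x)+g(x)u$, $x\in\mathbb{R}^n$, $u\in\mathbb{R}^m$, with $f:\mathbb{R}^n\to\mathbb{R}^n$ and $g:\mathbb{R}^n\to\mathbb{R}^{n\times m}$ locally Lipschitz. For a differentiable $\phi:\mathbb{R}^n\to\mathbb{R}$, $L_f\phi=\nabla\phi^\top f\in\mathbb{R}$ and $L_g\phi=\nabla\phi^\top g\in\mathbb{R}^{1\times m}$. $V:\mathbb{R}^n\to\mathbb{R}$ is a control Lyapunov function (CLF): $V$ is smooth and positive definite ($V(0)=0$, $V(x)>0$ for $x\ne0$), and $\inf_{u\in\mathbb{R}^m}[L_fV(x)+L_gV(x)u]\le-\gamma(V(x))$ for all $x\in\mathbb{R}^n$, where $\gamma:\mathbb{R}_{\ge0}\to\mathbb{R}_{\ge0}$ is class $\mathcal{K}$ (continuous, strictly increasing, $\gamma(0)=0$). $h:\mathbb{R}^n\to\mathbb{R}$ is a control barrier function (CBF): $h$ is smooth and $\sup_{u\in\mathbb{R}^m}[L_fh(x)+L_gh(x)u+\alpha(h(x))]\ge0$ for all $x\in\mathbb{R}^n$, where $\alpha:\mathbb{R}\to\mathbb{R}$ is a locally Lipschitz extended class $\mathcal{K}$ function (continuous, strictly increasing, $\alpha(0)=0$). The safety set is $\mathscr{C}=\{x: h(x)\ge0\}$, with $\mathrm{Int}(\mathscr{C})=\{x:h(x)>0\}$. The origin is in $\mathrm{Int}(\mathscr{C})$. These functions $\gamma,\alpha$ are the ones used in the quadratic program. Notation: $F_V=L_fV+\gamma(V)$, $F_h=L_fh+\alpha(h)$,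 and $\Omega^{clf}_{\overline{cbf}}=\{x\in\mathbb{R}^n: F_V\ge0,\ F_VL_ghL_gV^\top-F_h(1/p+L_gVL_gV^\top)<0\}$. *)

theory Defs
  imports "HOL-Analysis.Analysis"
begin

primrec Ck_differentiable :: "nat \<Rightarrow> (real^'n \<Rightarrow> real) \<Rightarrow> bool" where
  "Ck_differentiable 0 \<phi> \<longleftrightarrow> continuous_on UNIV \<phi>"
| "Ck_differentiable (Suc k) \<phi> \<longleftrightarrow>
     (\<forall>x. \<phi> differentiable (at x)) \<and>
     (\<forall>i. Ck_differentiable k (\<lambda>x. frechet_derivative \<phi> (at x) (axis i 1)))"

definition smooth :: "(real^'n \<Rightarrow> real) \<Rightarrow> bool" where
  "smooth \<phi> \<longleftrightarrow> (\<forall>k. Ck_differentiable k \<phi>)"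

(* local_lipschitz is about time-dependent maps; the first argument is a dummy time. *)
definition locally_lipschitz :: "('a::metric_space \<Rightarrow> 'b::metric_space) \<Rightarrow> bool" where
  "locally_lipschitz F \<longleftrightarrow> local_lipschitz (UNIV :: real set) UNIV (\<lambda>_. F)"

(* The values of a class K function outside {0..} are irrelevant. *)
definition class_K :: "(real \<Rightarrow> real) \<Rightarrow> bool" where
  "class_K \<gamma> \<longleftrightarrow> continuous_on {0..} \<gamma> \<and> strict_mono_on {0..} \<gamma> \<and> \<gamma> 0 = 0"

definition extended_class_K :: "(real \<Rightarrow> real) \<Rightarrow> bool" where
  "extended_class_K \<alpha> \<longleftrightarrow> continuous_on UNIV \<alpha> \<and> strict_mono \<alpha> \<and> \<alpha> 0 = 0"

definition gradient :: "(real^'n \<Rightarrow> real) \<Rightarrow> real^'n \<Rightarrow> real^'n" where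
  "gradient \<phi> x = (THE D. GDERIV \<phi> x :> D)"

definition Lie_f :: "(real^'n \<Rightarrow> real^'n) \<Rightarrow> (real^'n \<Rightarrow> real) \<Rightarrow> real^'n \<Rightarrow> real" where
  "Lie_f f \<phi> x = gradient \<phi> x \<bullet> f x"

(* The type real^'m^'n is that of matrices with 'n rows and 'm columns. The row vector
   L_g phi is represented as an element of real^'m, so that L_g phi u is an inner product. *)
definition Lie_g :: "(real^'n \<Rightarrow> real^'m^'n) \<Rightarrow> (real^'n \<Rightarrow> real) \<Rightarrow> real^'n \<Rightarrow> real^'m" where
  "Lie_g g \<phi> x = gradient \<phi> x v* g x"

(* The infimum (and, below, the supremum) over u is taken in the extended reals, since it is
   infinite wherever the Lie derivative along g does not vanish. *)
definition control_Lyapunov_function ::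
  "(real^'n \<Rightarrow> real^'n) \<Rightarrow> (real^'n \<Rightarrow> real^'m^'n) \<Rightarrow> (real \<Rightarrow> real) \<Rightarrow> (real^'n \<Rightarrow> real) \<Rightarrow> bool"
where
  "control_Lyapunov_function f g \<gamma> V \<longleftrightarrow>
     smooth V \<and> V 0 = 0 \<and> (\<forall>x. x \<noteq> 0 \<longrightarrow> V x > 0) \<and> class_K \<gamma> \<and>
     (\<forall>x. (INF u. ereal (Lie_f f V x + Lie_g g V x \<bullet> u)) \<le> ereal (- \<gamma> (V x)))"

definition control_barrier_function ::
  "(real^'n \<Rightarrow> real^'n) \<Rightarrow> (real^'n \<Rightarrow> real^'m^'n) \<Rightarrow> (real \<Rightarrow> real) \<Rightarrow> (real^'n \<Rightarrow> real) \<Rightarrow> bool"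
where
  "control_barrier_function f g \<alpha> h \<longleftrightarrow>
     smooth h \<and> extended_class_K \<alpha> \<and> locally_lipschitz \<alpha> \<and>
     (\<forall>x. (SUP u. ereal (Lie_f f h x + Lie_g g h x \<bullet> u + \<alpha> (h x))) \<ge> 0)"

definition Int_safe :: "(real^'n \<Rightarrow> real) \<Rightarrow> (real^'n) set" where
  "Int_safe h = {x. h x > 0}"

definition F_fun :: "(real^'n \<Rightarrow> real^'n) \<Rightarrow> (real \<Rightarrow> real) \<Rightarrow> (real^'n \<Rightarrow> real) \<Rightarrow> real^'n \<Rightarrow> real"
where
  "F_fun f \<kappa> \<phi> x = Lie_f f \<phi> x + \<kappa> (\<phi> x)"

(* Region where the CLF constraint is active and the CBF constraint is inactive. *)
definition Omega_clf_no_cbf ::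
  "(real^'n \<Rightarrow> real^'n) \<Rightarrow> (real^'n \<Rightarrow> real^'m^'n) \<Rightarrow> (real \<Rightarrow> real) \<Rightarrow> (real^'n \<Rightarrow> real) \<Rightarrow>
   (real \<Rightarrow> real) \<Rightarrow> (real^'n \<Rightarrow> real) \<Rightarrow> real \<Rightarrow> (real^'n) set"
where
  "Omega_clf_no_cbf f g \<gamma> V \<alpha> h p =
     {x. F_fun f \<gamma> V x \<ge> 0 \<and>
         F_fun f \<gamma> V x * (Lie_g g h x \<bullet> Lie_g g V x)
           - F_fun f \<alpha> h x * (1 / p + Lie_g g V x \<bullet> Lie_g g V x) < 0}"

definition QP_feasible ::
  "(real^'n \<Rightarrow> real^'n) \<Rightarrow> (real^'n \<Rightarrow> real^'m^'n) \<Rightarrow> (real \<Rightarrow> real) \<Rightarrow> (real^'n \<Rightarrow> real) \<Rightarrow>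
   (real \<Rightarrow> real) \<Rightarrow> (real^'n \<Rightarrow> real) \<Rightarrow> real^'n \<Rightarrow> ((real^'m) \<times> real) set"
where
  "QP_feasible f g \<gamma> V \<alpha> h x =
     {(u, \<delta>). Lie_f f V x + Lie_g g V x \<bullet> u + \<gamma> (V x) \<le> \<delta> \<and>
              Lie_f f h x + Lie_g g h x \<bullet> u + \<alpha> (h x) \<ge> 0}"

definition QP_cost :: "real \<Rightarrow> (real^'m) \<times> real \<Rightarrow> real" where
  "QP_cost p = (\<lambda>(u, \<delta>). 1 / 2 * (norm u)\<^sup>2 + 1 / 2 * p * \<delta>\<^sup>2)"

(* For p > 0 the cost is strictly convex and coercive, and the feasible set is a closed convex
   set, nonempty when h is a control barrier function; so the minimizer exists uniquely. *)
definition QP_control ::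
  "(real^'n \<Rightarrow> real^'n) \<Rightarrow> (real^'n \<Rightarrow> real^'m^'n) \<Rightarrow> (real \<Rightarrow> real) \<Rightarrow> (real^'n \<Rightarrow> real) \<Rightarrow>
   (real \<Rightarrow> real) \<Rightarrow> (real^'n \<Rightarrow> real) \<Rightarrow> real \<Rightarrow> real^'n \<Rightarrow> real^'m"
where
  "QP_control f g \<gamma> V \<alpha> h p x =
     fst (THE z. is_arg_min (QP_cost p) (\<lambda>z. z \<in> QP_feasible f g \<gamma> V \<alpha> h x) z)"

definition closed_loop ::
  "(real^'n \<Rightarrow> real^'n) \<Rightarrow> (real^'n \<Rightarrow> real^'m^'n) \<Rightarrow> (real^'n \<Rightarrow> real^'m) \<Rightarrow> real^'n \<Rightarrow> real^'n"
where
  "closed_loop f g k x = f x + g x *v k x"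

definition equilibrium :: "(real^'n \<Rightarrow> real^'n) \<Rightarrow> real^'n \<Rightarrow> bool" where
  "equilibrium F x \<longleftrightarrow> F x = 0"

end

theory Submission
  imports Defs
begin

text \<open>At an equilibrium \<open>f + g u = 0\<close> both Lie derivatives along the closed loop vanish, so the
  barrier constraint reads \<open>\<alpha>(h) \<ge> 0\<close>, which is strict in the interior of the safe set. The
  optimality conditions therefore involve the Lyapunov constraint alone; they force
  \<open>u = - p \<gamma>(V) (L\<^sub>g V)\<^sup>T\<close>, hence \<open>f = p \<gamma>(V) g (L\<^sub>g V)\<^sup>T\<close>, and eliminating \<open>u\<close> from the two
  constraints places the point in the excluded region.\<close>

lemma QP_min_exists_unique:
  fixes f :: "real^'n \<Rightarrow> real^'n" and g :: "real^'n \<Rightarrow> real^'m^'n"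
  assumes p: "p > 0" and ne: "QP_feasible f g \<gamma> V \<alpha> h x \<noteq> {}"
  shows "\<exists>!z. is_arg_min (QP_cost p) (\<lambda>z. z \<in> QP_feasible f g \<gamma> V \<alpha> h x) z"
proof -
  define r where "r = sqrt p"
  have r: "r > 0" "r\<^sup>2 = p" using p by (auto simp: r_def)
  define F where "F = QP_feasible f g \<gamma> V \<alpha> h x"
  \<comment> \<open>Rescaling the relaxation variable turns the cost into half the squared norm, so that the
    minimizer is the projection of the origin onto a closed convex set.\<close>
  define T :: "(real^'m) \<times> real \<Rightarrow> (real^'m) \<times> real" where "T = (\<lambda>(u, \<delta>). (u, r * \<delta>))"
  have cost: "QP_cost p z = 1/2 * (norm (T z))\<^sup>2" for z
    using r by (cases z) (auto simp: QP_cost_def T_def norm_Pair power_mult_distrib algebra_simps)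
  have injT: "T z = T w \<Longrightarrow> z = w" for z w
    using r by (cases z; cases w) (auto simp: T_def)
  define S where "S = T ` F"
  \<comment> \<open>In the scaled coordinates each constraint is a closed half-space, which yields
    closedness and convexity of \<open>S\<close> together.\<close>
  have S_eq: "S = {z. (Lie_g g V x, - (1/r)) \<bullet> z \<le> - (Lie_f f V x + \<gamma> (V x))} \<inter>
               {z. (Lie_g g h x, 0) \<bullet> z \<ge> - (Lie_f f h x + \<alpha> (h x))}" (is "_ = ?H")
  proof (rule set_eqI)
    fix z :: "(real^'m) \<times> real"
    obtain u s where z: "z = (u, s)" by (cases z)
    have "z \<in> S \<longleftrightarrow> (u, s / r) \<in> F"
    proof
      assume "z \<in> S"
      then show "(u, s / r) \<in> F" using r by (auto simp: S_def z T_def)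
    next
      assume "(u, s / r) \<in> F"
      moreover have "z = T (u, s / r)" using r by (simp add: z T_def)
      ultimately show "z \<in> S" by (simp add: S_def)
    qed
    also have "\<dots> \<longleftrightarrow> z \<in> ?H"
      by (auto simp: F_def QP_feasible_def z inner_Pair)
    finally show "z \<in> S \<longleftrightarrow> z \<in> ?H" .
  qed
  have cS: "closed S" unfolding S_eq by (intro closed_Int closed_halfspace_le closed_halfspace_ge)
  have vS: "convex S" unfolding S_eq by (intro convex_Int convex_halfspace_le convex_halfspace_ge)
  have min_iff: "is_arg_min (QP_cost p) (\<lambda>z. z \<in> F) z \<longleftrightarrow>
      T z \<in> S \<and> (\<forall>w\<in>S. dist 0 (T z) \<le> dist 0 w)" for z
  proof -
    have "T z \<in> S \<longleftrightarrow> z \<in> F" by (auto simp: S_def dest: injT)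
    then show ?thesis by (auto simp: is_arg_min_linorder cost S_def)
  qed
  have "S \<noteq> {}" using ne by (simp add: S_def F_def)
  then obtain c where "c \<in> S" "\<forall>w\<in>S. dist 0 c \<le> dist 0 w"
    using distance_attains_inf[OF cS, of 0] by metis
  then have "\<exists>z. is_arg_min (QP_cost p) (\<lambda>z. z \<in> F) z"
    unfolding min_iff by (auto simp: S_def)
  moreover have "z = w" if "is_arg_min (QP_cost p) (\<lambda>z. z \<in> F) z"
      "is_arg_min (QP_cost p) (\<lambda>z. z \<in> F) w" for z w
    using that any_closest_point_unique[OF vS cS, of "T z" "T w" 0] injT
    unfolding min_iff by blast
  ultimately show ?thesis unfolding F_def by blast
qed

text \<open>This makes the quadratic program feasible. Where \<open>Lie_g g h x\<close> vanishes the
  supremum runs over a constant; elsewhere the expression is a nonconstant affine function of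
  \<open>u\<close>, so it has a zero.\<close>

lemma CBF_control_exists:
  assumes "control_barrier_function f g \<alpha> h"
  shows "\<exists>u. Lie_f f h x + Lie_g g h x \<bullet> u + \<alpha> (h x) \<ge> 0"
proof (cases "Lie_g g h x = 0")
  case True
  then show ?thesis using assms
    by (auto simp: control_barrier_function_def zero_ereal_def dest!: spec[where x=x])
next
  case False
  let ?b = "Lie_g g h x" and ?c = "Lie_f f h x + \<alpha> (h x)"
  \<comment> \<open>The witness is the multiple of \<open>?b\<close> at which the affine function
    vanishes.\<close>
  have "Lie_f f h x + ?b \<bullet> (- (?c / (?b \<bullet> ?b)) *\<^sub>R ?b) + \<alpha> (h x) = 0"
    using False by simp
  then show ?thesis by (metis order_refl)
qed

text \<open>First-order optimality: the one-sided derivative of the cost at a minimizer cannot be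
  negative along a direction that stays feasible for small \<open>t\<close>.\<close>

lemma QP_min_directional:
  assumes min: "is_arg_min (QP_cost p) (\<lambda>z. z \<in> F) (u, \<delta>)"
    and ev: "eventually (\<lambda>t. (u + t *\<^sub>R v, \<delta> + t * \<epsilon>) \<in> F) (at_right 0)"
  shows "0 \<le> u \<bullet> v + p * \<delta> * \<epsilon>"
proof (rule tendsto_lowerbound)
  \<comment> \<open>\<open>?q t\<close> is the difference quotient of the quadratic cost along the
    ray, hence affine in \<open>t\<close>.\<close>
  let ?q = "\<lambda>t. (u \<bullet> v + p * \<delta> * \<epsilon>) + t * (1/2 * (v \<bullet> v + p * \<epsilon>\<^sup>2))"
  have "(?q \<longlongrightarrow> (u \<bullet> v + p * \<delta> * \<epsilon>) + 0 * (1/2 * (v \<bullet> v + p * \<epsilon>\<^sup>2))) (at_right 0)"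
    by (intro tendsto_intros)
  then show "(?q \<longlongrightarrow> u \<bullet> v + p * \<delta> * \<epsilon>) (at_right 0)" by simp
  show "eventually (\<lambda>t. 0 \<le> ?q t) (at_right 0)"
    using ev eventually_at_right_less[of 0]
  proof eventually_elim
    case (elim t)
    have "QP_cost p (u, \<delta>) \<le> QP_cost p (u + t *\<^sub>R v, \<delta> + t * \<epsilon>)"
      using min elim(1) by (simp add: is_arg_min_linorder)
    also have "\<dots> = QP_cost p (u, \<delta>) + t * ?q t"
      by (simp add: QP_cost_def power2_norm_eq_inner inner_add inner_commute[of v u])
        (simp add: algebra_simps power2_eq_square add_divide_distrib)
    finally have "0 \<le> t * ?q t" by simp
    with elim(2) show ?case by (simp add: zero_le_mult_iff)
  qed
qed simp

text \<open>These are the KKT conditions with zero barrier multiplier, derived from feasible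
  directions: strict slack in the barrier constraint survives every small move of
  \<open>u\<close>.\<close>

lemma QP_min_CBF_inactive:
  fixes f :: "real^'n \<Rightarrow> real^'n" and g :: "real^'n \<Rightarrow> real^'m^'n"
  assumes p: "p > 0"
    and min: "is_arg_min (QP_cost p) (\<lambda>z. z \<in> QP_feasible f g \<gamma> V \<alpha> h x) (u, \<delta>)"
    and slack: "Lie_f f h x + Lie_g g h x \<bullet> u + \<alpha> (h x) > 0"
    and CLF_pos: "Lie_f f V x + Lie_g g V x \<bullet> u + \<gamma> (V x) > 0"
  shows "u = - (p * \<delta>) *\<^sub>R Lie_g g V x"
    and "Lie_f f V x + Lie_g g V x \<bullet> u + \<gamma> (V x) = \<delta>"
proof -
  let ?F = "QP_feasible f g \<gamma> V \<alpha> h x" and ?a = "Lie_g g V x"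
  have feas: "Lie_f f V x + ?a \<bullet> u + \<gamma> (V x) \<le> \<delta>"
    using min by (simp add: is_arg_min_def QP_feasible_def)
  have ev_cbf: "eventually (\<lambda>t. 0 < Lie_f f h x + Lie_g g h x \<bullet> (u + t *\<^sub>R v) + \<alpha> (h x))
      (at_right 0)" for v
  proof (rule order_tendstoD(1)[OF _ slack])
    have "((\<lambda>t. Lie_f f h x + Lie_g g h x \<bullet> (u + t *\<^sub>R v) + \<alpha> (h x)) \<longlongrightarrow>
        Lie_f f h x + Lie_g g h x \<bullet> (u + 0 *\<^sub>R v) + \<alpha> (h x)) (at_right 0)"
      by (intro tendsto_intros)
    then show "((\<lambda>t. Lie_f f h x + Lie_g g h x \<bullet> (u + t *\<^sub>R v) + \<alpha> (h x)) \<longlongrightarrow>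
        Lie_f f h x + Lie_g g h x \<bullet> u + \<alpha> (h x)) (at_right 0)" by simp
  qed
  \<comment> \<open>Moving along the hyperplane \<open>\<epsilon> = L\<^sub>g V v\<close> preserves the slack of the Lyapunov constraint.\<close>
  have dir: "0 \<le> (u + (p * \<delta>) *\<^sub>R ?a) \<bullet> v" for v
  proof -
    have "eventually (\<lambda>t. (u + t *\<^sub>R v, \<delta> + t * (?a \<bullet> v)) \<in> ?F) (at_right 0)"
      using ev_cbf[of v] by eventually_elim (use feas in \<open>simp add: QP_feasible_def inner_add\<close>)
    from QP_min_directional[OF min this] show ?thesis by (simp add: inner_add)
  qed
  \<comment> \<open>Testing against the negative of the vector itself makes minus its squared norm
    nonnegative.\<close>
  from dir[of "- (u + (p * \<delta>) *\<^sub>R ?a)"] have "u + (p * \<delta>) *\<^sub>R ?a = 0"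
    by (metis inner_minus_right neg_0_le_iff_le inner_ge_zero inner_eq_zero_iff order_antisym)
  then show "u = - (p * \<delta>) *\<^sub>R ?a" by (simp add: eq_neg_iff_add_eq_0)
  show "Lie_f f V x + ?a \<bullet> u + \<gamma> (V x) = \<delta>"
  proof (rule ccontr)
    assume "\<not> ?thesis"
    with feas have lt: "Lie_f f V x + ?a \<bullet> u + \<gamma> (V x) < \<delta>" by simp
    \<comment> \<open>With slack left, \<delta> could be lowered while \<open>u\<close> stays fixed.
      Optimality then gives \<open>\<delta> \<le> 0\<close>, although \<delta> exceeds the positive
      left side.\<close>
    have "((\<lambda>t::real. \<delta> + t * (-1)) \<longlongrightarrow> \<delta> + 0 * (-1)) (at_right 0)"
      by (intro tendsto_intros)
    then have "eventually (\<lambda>t. Lie_f f V x + ?a \<bullet> u + \<gamma> (V x) < \<delta> + t * (-1)) (at_right 0)"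
      using lt by (intro order_tendstoD(1)) auto
    with ev_cbf[of 0] have "eventually (\<lambda>t. (u + t *\<^sub>R 0, \<delta> + t * (-1)) \<in> ?F) (at_right 0)"
      by eventually_elim (simp add: QP_feasible_def)
    from QP_min_directional[OF min this] p have "\<delta> \<le> 0" by (simp add: mult_le_0_iff)
    with lt CLF_pos show False by linarith
  qed
qed

lemma class_K_pos:
  assumes "class_K \<gamma>" and "0 < r"
  shows "0 < \<gamma> r"
  using assms strict_mono_onD[of "{0..}" \<gamma> 0 r] by (auto simp: class_K_def)

lemma extended_class_K_pos:
  assumes "extended_class_K \<alpha>" and "0 < r"
  shows "0 < \<alpha> r"
  using assms strict_monoD[of \<alpha> 0 r] by (auto simp: extended_class_K_def)

lemma Lie_closed_loop:
  "Lie_f f \<phi> x + Lie_g g \<phi> x \<bullet> k x = gradient \<phi> x \<bullet> closed_loop f g k x"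
  by (simp add: Lie_f_def Lie_g_def closed_loop_def dot_lmul_matrix inner_add_right)

theorem proposition1:
  fixes f :: "real^'n \<Rightarrow> real^'n"
    and g :: "real^'n \<Rightarrow> real^'m^'n"
    and V h :: "real^'n \<Rightarrow> real"
    and \<gamma> \<alpha> :: "real \<Rightarrow> real"
    and p :: real
  assumes "locally_lipschitz f"
    and "locally_lipschitz g"
    and "control_Lyapunov_function f g \<gamma> V"
    and "control_barrier_function f g \<alpha> h"
    and "0 \<in> Int_safe h"
    and "p > 0"
    and "\<not> (\<exists>x. x \<noteq> 0 \<and> x \<in> Omega_clf_no_cbf f g \<gamma> V \<alpha> h p \<inter> Int_safe h \<and>
               f x = (p * \<gamma> (V x)) *\<^sub>R (g x *v Lie_g g V x))"
  shows "\<not> (\<exists>x. x \<in> Int_safe h \<and> x \<noteq> 0 \<and>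
               equilibrium (closed_loop f g (QP_control f g \<gamma> V \<alpha> h p)) x)"
proof
  let ?k = "QP_control f g \<gamma> V \<alpha> h p"
  assume "\<exists>x. x \<in> Int_safe h \<and> x \<noteq> 0 \<and> equilibrium (closed_loop f g ?k) x"
  then obtain x where x: "x \<in> Int_safe h" "x \<noteq> 0" and eq: "closed_loop f g ?k x = 0"
    by (auto simp: equilibrium_def)
  let ?F = "QP_feasible f g \<gamma> V \<alpha> h x" and ?a = "Lie_g g V x" and ?b = "Lie_g g h x"
  have \<gamma>: "0 < \<gamma> (V x)"
    using assms(3) x(2) by (auto simp: control_Lyapunov_function_def intro: class_K_pos)
  have \<alpha>: "0 < \<alpha> (h x)"
    using assms(4) x(1)
    by (auto simp: control_barrier_function_def Int_safe_def intro: extended_class_K_pos)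
  obtain w where "Lie_f f h x + ?b \<bullet> w + \<alpha> (h x) \<ge> 0"
    using CBF_control_exists[OF assms(4)] by blast
  \<comment> \<open>Taking the relaxation equal to the Lyapunov expression satisfies that constraint
    with equality, for any \<open>w\<close>.\<close>
  then have "(w, Lie_f f V x + ?a \<bullet> w + \<gamma> (V x)) \<in> ?F" by (simp add: QP_feasible_def)
  then have ex1: "\<exists>!z. is_arg_min (QP_cost p) (\<lambda>z. z \<in> ?F) z"
    using QP_min_exists_unique[OF assms(6)] by blast
  define z where "z = (THE z. is_arg_min (QP_cost p) (\<lambda>z. z \<in> ?F) z)"
  define u where "u = ?k x"
  define \<delta> where "\<delta> = snd z"
  have "z = (u, \<delta>)" by (simp add: u_def QP_control_def z_def \<delta>_def)
  with theI'[OF ex1] have min: "is_arg_min (QP_cost p) (\<lambda>z. z \<in> ?F) (u, \<delta>)"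
    by (simp add: z_def)
  have Lie_0: "Lie_f f V x + ?a \<bullet> u = 0" "Lie_f f h x + ?b \<bullet> u = 0"
    using Lie_closed_loop[of f _ x g ?k] eq by (simp_all add: u_def)
  have "\<gamma> (V x) = \<delta>"
    using QP_min_CBF_inactive(2)[OF assms(6) min] Lie_0 \<gamma> \<alpha> by simp
  with QP_min_CBF_inactive(1)[OF assms(6) min] have u: "u = - (p * \<gamma> (V x)) *\<^sub>R ?a"
    using Lie_0 \<gamma> \<alpha> by simp
  have f_eq: "f x = (p * \<gamma> (V x)) *\<^sub>R (g x *v ?a)"
    using eq unfolding closed_loop_def u_def[symmetric] u
    by (simp only: matrix_vector_mult_scaleR) (simp add: add_eq_0_iff2)
  let ?s = "1 / p + ?a \<bullet> ?a"
  have s: "0 < ?s" using assms(6) by (simp add: add_pos_nonneg)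
  \<comment> \<open>At the equilibrium \<open>Lie_f f V x\<close> equals
    \<open>- (?a \<bullet> u)\<close>, and \<open>u\<close> is now explicit; the same substitution
    gives \<open>Fh\<close>.\<close>
  have FV: "F_fun f \<gamma> V x = p * \<gamma> (V x) * ?s"
    using Lie_0(1) assms(6) by (simp add: u F_fun_def algebra_simps)
  have Fh: "F_fun f \<alpha> h x = p * \<gamma> (V x) * (?b \<bullet> ?a) + \<alpha> (h x)"
    using Lie_0(2) by (simp add: u F_fun_def algebra_simps)
  \<comment> \<open>The terms containing \<open>?b \<bullet> ?a\<close> cancel, so the strict
    inequality defining the region reduces to positivity of \<open>\<alpha> (h x)\<close>.\<close>
  have "F_fun f \<gamma> V x * (?b \<bullet> ?a) - F_fun f \<alpha> h x * ?s = - (\<alpha> (h x) * ?s)"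
    unfolding FV Fh by (simp only: algebra_simps)
  moreover have "0 < \<alpha> (h x) * ?s" using \<alpha> s by simp
  moreover have "0 \<le> F_fun f \<gamma> V x" using FV \<gamma> s assms(6) by simp
  ultimately have "x \<in> Omega_clf_no_cbf f g \<gamma> V \<alpha> h p" by (simp add: Omega_clf_no_cbf_def)
  with assms(7) x f_eq show False by blast
qed

end
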